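(* Let $\xi:\Omega\to\overline{\mathbb R}$ be any function and let $s\in\mathcal X^*$ be any situation. Then $$\overline{\mathbb E}(\xi\mid s)=\inf\Bigl\{\mathcal S(s)\ \Bigm|\ \limsup_{n\to\infty}\mathcal S(\omega^n)\ge\xi(\omega)\text{ for all }\omega\in\Gamma(s)\Bigr\},$$ where $\mathcal S$ ranges over the supermartingales that are bounded below, and $$\overline{\mathbb E}(\xi\mid s)=\inf\Bigl\{\mathcal S(s)\ \Bigm|\ \lim_{n\to\infty}\mathcal S(\omega^n)\ge\xi(\omega)\text{ for all }\omega\in\Gamma(s)\Bigr\},$$ where $\mathcal S$ ranges over the class $\mathbf L$ of all bounded below supermartingales for which $\lim_{n\to\infty}\mathcal S(\omega^n)$ exists in $(-\infty,\infty]$ for all $\omega\in\Omega$.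
   Context: Conventions: $\mathbb N=\{1,2,\ldots\}$, $\overline{\mathbb R}=[-\infty,\infty]$, $0\times\infty:=0$ and $\infty+(-\infty):=\infty$. For a non-empty set $X$, an outer probability content on $X$ is a function $\mathcal E:\overline{\mathbb R}^X\to\overline{\mathbb R}$ such that: (1) $f\le g$ implies $\mathcal E(f)\le\mathcal E(g)$; (2) $\mathcal E(cf)=c\,\mathcal E(f)$ for all $f$ and $c\in(0,\infty)$; (3) $\mathcal E(f+g)\le\mathcal E(f)+\mathcal E(g)$ for all $f,g$; (4) $\mathcal E(c)=c$ for every $c\in\mathbb R$ (the argument being the constant function $c$). Setting: a non-empty set $\mathcal X$ and outer probability contents $\mathcal E_1,\mathcal E_2,\ldots$ on $\mathcal X$ are fixed. The sample space is $\Omega:=\mathcal X^\infty$ (infinite sequences); situations are elements of $\mathcal X^*:=\bigcup_{n\ge0}\mathcal X^n$. For a situation $s$, $\Gamma(s)\subseteq\Omega$ is the set of infinite sequences having $s$ as a prefix; $sx$ is $s$ with $x\in\mathcal X$ appended. For $\omega\in\Omega$ and $n\ge0$, $\omega^n$ is the prefix of $\omega$ of length $n$. A supermartingale is a function $\mathcal S:\mathcal X^*\to\overline{\mathbb R}$ such that $\mathcal E_n(\mathcal S(s\,\cdot))\le\mathcal S(s)$ for all $n\in\mathbb N$ and $s\in\mathcal X^{n-1}$, where $\mathcal S(s\,\cdot)$ is the function $x\mapsto\mathcal S(sx)$. It is bounded below if $\inf\mathcal S>-\infty$. For $\xi:\Omega\to\overline{\mathbb R}$ and a situation $s$, the upper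 expectation is $$\overline{\mathbb E}(\xi\mid s):=\inf\bigl\{\mathcal S(s)\bigm|\liminf_{n\to\infty}\mathcal S(\omega^n)\ge\xi(\omega)\text{ for all }\omega\in\Gamma(s)\bigr\},$$ $\mathcal S$ ranging over the supermartingales that are bounded below. *)

theory Defs
  imports Complex_Main "HOL-Library.Extended_Real" "HOL-Library.Liminf_Limsup" "HOL-Library.Stream"
begin

text \<open>
  The non-empty set \<open>X\<close> is the universe of the type \<open>'a\<close>. Situations are lists over \<open>'a\<close>, the
  sample space is the type of streams over \<open>'a\<close>, and the prefix of \<open>\<omega>\<close> of length \<open>n\<close> is
  \<open>stake n \<omega>\<close>. Addition and multiplication on \<^typ>\<open>ereal\<close> satisfy \<open>\<infinity> + (-\<infinity>) = \<infinity>\<close> and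
  \<open>0 * \<infinity> = 0\<close>.
\<close>

definition outer_prob_content :: "(('a \<Rightarrow> ereal) \<Rightarrow> ereal) \<Rightarrow> bool" where
  "outer_prob_content \<E> \<longleftrightarrow>
     (\<forall>f g. (\<forall>x. f x \<le> g x) \<longrightarrow> \<E> f \<le> \<E> g) \<and>
     (\<forall>f. \<forall>c::real. 0 < c \<longrightarrow> \<E> (\<lambda>x. ereal c * f x) = ereal c * \<E> f) \<and>
     (\<forall>f g. \<E> (\<lambda>x. f x + g x) \<le> \<E> f + \<E> g) \<and>
     (\<forall>c::real. \<E> (\<lambda>x. ereal c) = ereal c)"

definition cylinder :: "'a list \<Rightarrow> 'a stream set" where
  "cylinder s = {\<omega>. stake (length s) \<omega> = s}"

text \<open>The contents are indexed from 1; the value \<open>\<E> 0\<close> is never used.\<close>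

definition supermartingale :: "(nat \<Rightarrow> ('a \<Rightarrow> ereal) \<Rightarrow> ereal) \<Rightarrow> ('a list \<Rightarrow> ereal) \<Rightarrow> bool" where
  "supermartingale \<E> S \<longleftrightarrow>
     (\<forall>n\<ge>1. \<forall>s. length s = n - 1 \<longrightarrow> \<E> n (\<lambda>x. S (s @ [x])) \<le> S s)"

definition bounded_below :: "('a list \<Rightarrow> ereal) \<Rightarrow> bool" where
  "bounded_below S \<longleftrightarrow> (INF s. S s) > -\<infinity>"

definition upper_expectation ::
  "(nat \<Rightarrow> ('a \<Rightarrow> ereal) \<Rightarrow> ereal) \<Rightarrow> ('a stream \<Rightarrow> ereal) \<Rightarrow> 'a list \<Rightarrow> ereal" where
  "upper_expectation \<E> \<xi> s =
     Inf {S s | S. supermartingale \<E> S \<and> bounded_below S \<and>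
       (\<forall>\<omega>\<in>cylinder s. liminf (\<lambda>n. S (stake n \<omega>)) \<ge> \<xi> \<omega>)}"

definition convergent_supermartingales ::
  "(nat \<Rightarrow> ('a \<Rightarrow> ereal) \<Rightarrow> ereal) \<Rightarrow> ('a list \<Rightarrow> ereal) set" where
  "convergent_supermartingales \<E> =
     {S. supermartingale \<E> S \<and> bounded_below S \<and>
       (\<forall>\<omega>. \<exists>L. -\<infinity> < L \<and> (\<lambda>n. S (stake n \<omega>)) \<longlonglongrightarrow> L)}"

end

theory Submission
  imports Defs "HOL-Analysis.Uniform_Limit"
begin

text \<open>
  The only nontrivial point is that a bounded below supermartingale \<open>S\<close> with \<open>S s < \<infinity>\<close> can be
  replaced, at an arbitrarily small cost at \<open>s\<close>, by one that converges on every path to a limit of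
  at least \<open>limsup S\<close>. As in Doob's convergence theorem, one adds to \<open>S\<close> a small multiple of a
  mixture of the upcrossing strategies for countably many intervals \<open>[a, b]\<close>. These are taken in
  additive form: the capital is \<open>b - a\<close> times the number of completed upcrossings plus a bounded
  amount that converges whenever \<open>S\<close> does and the number of upcrossings stays bounded. Hence the
  mixture tends to infinity where \<open>S\<close> diverges, and elsewhere it converges or tends to infinity.
\<close>

section \<open>Outer probability contents\<close>

context
  fixes E :: "('a \<Rightarrow> ereal) \<Rightarrow> ereal"
  assumes E: "outer_prob_content E"
begin

lemma content_mono: "(\<And>x. f x \<le> g x) \<Longrightarrow> E f \<le> E g"
  using E unfolding outer_prob_content_def by blast

lemma content_add: "E (\<lambda>x. f x + g x) \<le> E f + E g"
  using E unfolding outer_prob_content_def by blast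

lemma content_const: "E (\<lambda>x. ereal c) = ereal c"
  using E unfolding outer_prob_content_def by blast

lemma content_scale: "0 < c \<Longrightarrow> E (\<lambda>x. ereal c * f x) = ereal c * E f"
  using E unfolding outer_prob_content_def by blast

lemma content_affine:
  assumes "0 < m" and "E (\<lambda>x. ereal (f x)) \<le> ereal y"
  shows "E (\<lambda>x. ereal (m * f x + d)) \<le> ereal (m * y + d)"
proof -
  have "E (\<lambda>x. ereal (m * f x + d)) \<le> E (\<lambda>x. ereal m * ereal (f x)) + E (\<lambda>x. ereal d)"
    using content_add[of "\<lambda>x. ereal m * ereal (f x)" "\<lambda>x. ereal d"] by simp
  also have "\<dots> \<le> ereal m * ereal y + ereal d"
    unfolding content_const content_scale[OF assms(1)]
    using assms by (intro add_mono ereal_mult_left_mono) auto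
  finally show ?thesis by simp
qed

lemma content_sum:
  fixes m :: nat
  assumes "\<And>k. k < m \<Longrightarrow> E (\<lambda>x. ereal (f k x)) \<le> ereal (y k)"
  shows "E (\<lambda>x. ereal (\<Sum>k<m. f k x)) \<le> ereal (\<Sum>k<m. y k)"
  using assms
proof (induction m)
  case 0
  then show ?case using content_const[of 0] by simp
next
  case (Suc m)
  have "E (\<lambda>x. ereal (\<Sum>k<Suc m. f k x)) \<le> E (\<lambda>x. ereal (\<Sum>k<m. f k x)) + E (\<lambda>x. ereal (f m x))"
    using content_add[of "\<lambda>x. ereal (\<Sum>k<m. f k x)" "\<lambda>x. ereal (f m x)"] by simp
  also have "\<dots> \<le> ereal (\<Sum>k<m. y k) + ereal (y m)"
    by (intro add_mono Suc.IH Suc.prems) simp_all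
  finally show ?case by simp
qed

text \<open>Outer contents need not be countably subadditive; here the uniform majorant makes the tails
  of the series uniformly small.\<close>

lemma content_suminf:
  assumes le: "\<And>k. E (\<lambda>x. ereal (f k x)) \<le> ereal (y k)"
    and bound: "\<And>k x. \<bar>f k x\<bar> \<le> g k" and g: "summable g" and y: "summable y"
  shows "E (\<lambda>x. ereal (\<Sum>k. f k x)) \<le> ereal (\<Sum>k. y k)"
proof -
  have f: "summable (\<lambda>k. f k x)" for x
    by (rule summable_comparison_test[OF _ g]) (use bound in auto)
  have "E (\<lambda>x. ereal (\<Sum>k. f k x)) \<le> ereal ((\<Sum>k<m. y k) + (\<Sum>k. g (k + m)))" for m
  proof -
    have "(\<Sum>k. f k x) \<le> (\<Sum>k<m. f k x) + (\<Sum>k. g (k + m))" for x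
    proof -
      have "f (k + m) x \<le> g (k + m)" for k
        using bound[of "k + m" x] by simp
      then have "(\<Sum>k. f (k + m) x) \<le> (\<Sum>k. g (k + m))"
        using summable_ignore_initial_segment[OF f] summable_ignore_initial_segment[OF g]
        by (rule suminf_le)
      then show ?thesis
        using suminf_split_initial_segment[OF f, of x m] by simp
    qed
    \<comment> \<open>The constant that bounds the tail does not depend on \<open>x\<close>, so only
      finite sums remain; the factor \<open>1\<close> fits the shape of
      \<open>content_affine\<close>.\<close>
    then have "E (\<lambda>x. ereal (\<Sum>k. f k x)) \<le> E (\<lambda>x. ereal (1 * (\<Sum>k<m. f k x) + (\<Sum>k. g (k + m))))"
      by (intro content_mono) simp
    also have "\<dots> \<le> ereal (1 * (\<Sum>k<m. y k) + (\<Sum>k. g (k + m)))"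
      by (intro content_affine content_sum le) auto
    finally show ?thesis by simp
  qed
  moreover have "(\<lambda>m. \<Sum>k. g (k + m)) \<longlonglongrightarrow> 0"
    using tendsto_diff[OF tendsto_const[of "suminf g"] summable_LIMSEQ[OF g]]
    by (simp add: suminf_minus_initial_segment[OF g])
  then have "(\<lambda>m. ereal ((\<Sum>k<m. y k) + (\<Sum>k. g (k + m)))) \<longlonglongrightarrow> ereal ((\<Sum>k. y k) + 0)"
    using summable_LIMSEQ[OF y] by (intro tendsto_intros)
  ultimately show ?thesis
    using LIMSEQ_le_const by fastforce
qed

end

section \<open>Upcrossings\<close>

text \<open>The state of a trader who buys at a price of at most \<open>a\<close> and later sells at a price of at
  least \<open>b\<close>: whether the trader holds a unit, and the number of completed sales.\<close>

primrec trader :: "real \<Rightarrow> real \<Rightarrow> (nat \<Rightarrow> ereal) \<Rightarrow> nat \<Rightarrow> bool \<times> nat" where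
  "trader a b v 0 = (False, 0)"
| "trader a b v (Suc n) = (case trader a b v n of
     (False, N) \<Rightarrow> (v (Suc n) \<le> ereal a, N)
   | (True, N) \<Rightarrow> if ereal b \<le> v (Suc n) then (False, Suc N) else (True, N))"

abbreviation holds where "holds a b v n \<equiv> fst (trader a b v n)"
abbreviation sales where "sales a b v n \<equiv> snd (trader a b v n)"

text \<open>Out of the market the trader keeps \<open>a\<close> in cash; buying below
  \<open>a\<close> gives the difference away. With \<open>a < b\<close> and \<open>v\<close> bounded
  below by a real, \<open>real_of_ereal\<close> meets no infinite value, since a unit is held only
  at prices below \<open>b\<close>.\<close>

definition holding :: "real \<Rightarrow> real \<Rightarrow> (nat \<Rightarrow> ereal) \<Rightarrow> nat \<Rightarrow> real" where
  "holding a b v n = (if holds a b v n then real_of_ereal (v n) else a)"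

text \<open>The trader starts with capital \<open>a\<close> and each sale yields exactly \<open>b\<close>, any excess being
  given away; this keeps the holding bounded.\<close>

definition capital :: "real \<Rightarrow> real \<Rightarrow> (nat \<Rightarrow> ereal) \<Rightarrow> nat \<Rightarrow> real" where
  "capital a b v n = (b - a) * real (sales a b v n) + holding a b v n"

text \<open>Non-anticipation: it makes the capital a function of situations and lets later values of
  \<open>v\<close> be overwritten freely.\<close>

lemma trader_cong: "(\<And>i. i \<le> n \<Longrightarrow> v i = w i) \<Longrightarrow> trader a b v n = trader a b w n"
  by (induction n) (auto split: prod.splits bool.splits)

lemma capital_cong: "(\<And>i. i \<le> n \<Longrightarrow> v i = w i) \<Longrightarrow> capital a b v n = capital a b w n"
  using trader_cong[of n v w a b] by (simp add: capital_def holding_def)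

lemma sales_Suc: "sales a b v n \<le> sales a b v (Suc n)"
  by (auto split: prod.splits bool.splits)

lemma incseq_sales: "incseq (sales a b v)"
  using sales_Suc by (intro incseq_SucI)

lemma sales_le: "sales a b v n \<le> n"
  by (induction n) (auto split: prod.splits bool.splits)

text \<open>The unit was either bought just now, at a price of at most \<open>a\<close>, or kept
  because the price did not reach \<open>b\<close>.\<close>

lemma holds_less:
  assumes "a < b" "holds a b v n"
  shows "v n < ereal b"
  using assms
proof (cases n)
  case (Suc m)
  have "ereal a < ereal b" using assms by simp
  then show ?thesis
    using assms(2) Suc by (auto split: prod.splits bool.splits if_splits simp del: less_ereal.simps)
qed simp

lemma holding_eq:
  assumes "a < b" "holds a b v n" "ereal (- c) \<le> v n"
  shows "ereal (holding a b v n) = v n"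
  using holds_less[OF assms(1,2)] assms by (cases "v n") (auto simp: holding_def)

text \<open>The bound is uniform in \<open>v\<close> and \<open>n\<close>: the weights are
  normalised by it, and the later exchange of limit and sum rests on it.\<close>

lemma abs_holding_le:
  assumes "a < b" "\<And>n. ereal (- c) \<le> v n"
  shows "\<bar>holding a b v n\<bar> \<le> \<bar>a\<bar> + \<bar>b\<bar> + \<bar>c\<bar>"
proof (cases "holds a b v n")
  case True
  then show ?thesis
    using holding_eq[OF assms(1) True assms(2)] holds_less[OF assms(1) True] assms(2)[of n]
    by (cases "v n") auto
qed (simp add: holding_def)

text \<open>Without a unit, the capital cannot grow in one step; with a unit, it grows at most by
  the price change, which \<open>le\<close> controls. The updated sequence is the path continued by
  \<open>x\<close>.\<close>

lemma content_capital:
  fixes v :: "nat \<Rightarrow> ereal" and h :: "'a \<Rightarrow> ereal"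
  assumes E: "outer_prob_content E" and ab: "a < b"
    and low: "\<And>i. ereal (- c) \<le> v i" "\<And>x. ereal (- c) \<le> h x"
    and le: "E h \<le> v n"
  shows "E (\<lambda>x. ereal (capital a b (v(Suc n := h x)) (Suc n))) \<le> ereal (capital a b v n)"
proof -
  have tr: "trader a b (v(Suc n := y)) n = trader a b v n" for y
    by (rule trader_cong) auto
  obtain p N where pN: "trader a b v n = (p, N)" by fastforce
  show ?thesis
  proof (cases p)
    case False
    have "capital a b (v(Suc n := h x)) (Suc n) \<le> capital a b v n" for x
      using low(2)[of x] pN False tr[of "h x"]
      by (cases "h x") (auto simp: capital_def holding_def)
    then have "E (\<lambda>x. ereal (capital a b (v(Suc n := h x)) (Suc n)))
        \<le> E (\<lambda>x. ereal (capital a b v n))"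
      by (intro content_mono[OF E]) simp
    then show ?thesis by (simp add: content_const[OF E])
  next
    case True
    \<comment> \<open>Equality if the unit is kept; on a sale \<open>h x\<close> is replaced by
      \<open>b\<close>, which is no larger.\<close>
    have "ereal (capital a b (v(Suc n := h x)) (Suc n)) \<le> ereal ((b - a) * N) + h x" for x
      using low(2)[of x] pN True tr[of "h x"]
      by (cases "h x") (auto simp: capital_def holding_def algebra_simps)
    then have "E (\<lambda>x. ereal (capital a b (v(Suc n := h x)) (Suc n)))
        \<le> E (\<lambda>x. ereal ((b - a) * N) + h x)"
      by (intro content_mono[OF E])
    also have "\<dots> \<le> ereal ((b - a) * N) + v n"
      using content_add[OF E, of "\<lambda>x. ereal ((b - a) * N)" h] le
      by (simp add: content_const[OF E]) (meson add_left_mono order_trans)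
    also have "\<dots> = ereal (capital a b v n)"
        using holding_eq[where v = v and n = n, OF ab _ low(1)] pN True
      by (simp add: capital_def plus_ereal.simps(1)[symmetric] del: plus_ereal.simps(1))
    finally show ?thesis .
  qed
qed

lemma eventually_sales_eq:
  assumes "\<And>n. sales a b v n \<le> K"
  shows "\<exists>m. \<forall>n\<ge>m. sales a b v n = sales a b v m"
proof -
  have "range (sales a b v) \<subseteq> {..K}"
    using assms by blast
  then have "finite (range (sales a b v))"
    by (rule finite_subset) (rule finite_atMost)
  then have "Max (range (sales a b v)) \<in> range (sales a b v)"
    by (intro Max_in) auto
  then obtain m where "Max (range (sales a b v)) = sales a b v m"
    by (rule imageE)
  then have "sales a b v n \<le> sales a b v m" for n
    using Max_ge[OF \<open>finite _\<close> rangeI, of n] by simp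
  then show ?thesis
    using incseq_sales[of a b v] by (meson incseqD order_antisym)
qed

text \<open>A unit is given up only by a sale, which would raise the count.\<close>

lemma holds_persists:
  assumes "\<And>n. n \<ge> m \<Longrightarrow> sales a b v n = sales a b v m" "holds a b v k" "m \<le> k" "k \<le> n"
  shows "holds a b v n"
  using assms(4)
proof (induction n rule: dec_induct)
  case (step n)
  then show ?case
    using assms(1)[of n] assms(1)[of "Suc n"] assms(3)
    by (auto split: prod.splits bool.splits if_splits)
qed (use assms in simp)

text \<open>If sales stopped for good, a later price below \<open>a\<close> would leave the trader
  with a unit, and a price above \<open>b\<close> after that would force one more sale.\<close>

lemma sales_unbounded:
  assumes "frequently (\<lambda>n. v n < ereal a) sequentially"
    and "frequently (\<lambda>n. v n > ereal b) sequentially"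
  shows "\<exists>n. sales a b v n > K"
proof (rule ccontr)
  assume "\<not> ?thesis"
  then obtain m where m: "\<And>n. n \<ge> m \<Longrightarrow> sales a b v n = sales a b v m"
    using eventually_sales_eq[of a b v K] by (metis not_le)
  obtain k where k: "k > m" "v k < ereal a"
    using assms(1) unfolding frequently_sequentially less_eq_Suc_le by blast
  \<comment> \<open>At time \<open>k\<close> a trader without a unit buys, so a unit is held at
    \<open>k - 1\<close> or at \<open>k\<close>; \<open>k > m\<close> keeps both times beyond
    \<open>m\<close>.\<close>
  have "\<exists>j\<ge>m. holds a b v j"
  proof (rule ccontr)
    assume none: "\<not> ?thesis"
    obtain i where "k = Suc i" "i \<ge> m" using k(1) by (cases k) auto
    then have "\<not> holds a b v i" "\<not> holds a b v (Suc i)"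
      using none \<open>i \<ge> m\<close> le_SucI[OF \<open>i \<ge> m\<close>] by blast+
    then show False
      using k \<open>k = Suc i\<close> by (auto split: prod.splits bool.splits)
  qed
  then obtain j where j: "j \<ge> m" "holds a b v j" by blast
  obtain l where l: "l > j" "v l > ereal b"
    using assms(2) unfolding frequently_sequentially less_eq_Suc_le by blast
  obtain i where i: "l = Suc i" "i \<ge> j" using l(1) by (cases l) auto
  have "holds a b v i"
    using holds_persists[OF m j(2,1) i(2)] .
  then have "sales a b v l = Suc (sales a b v i)"
    using i l by (auto split: prod.splits bool.splits)
  then show False using m[of l] m[of i] i j by simp
qed

text \<open>After the last sale the trader either holds a unit forever, and the holding follows
  \<open>v\<close>, or never again, and it is constantly \<open>a\<close>.\<close>

lemma convergent_holding:
  assumes "a < b" "\<And>n. ereal (- c) \<le> v n" "v \<longlonglongrightarrow> L" "\<And>n. sales a b v n \<le> K"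
  shows "convergent (holding a b v)"
proof -
  obtain m where m: "\<And>n. n \<ge> m \<Longrightarrow> sales a b v n = sales a b v m"
    using eventually_sales_eq assms(4) by metis
  show ?thesis
  proof (cases "\<exists>k\<ge>m. holds a b v k")
    case True
    then obtain k where k: "k \<ge> m" "holds a b v k" by blast
    have h: "holds a b v n" if "n \<ge> k" for n
      using holds_persists[OF m k(2,1) that] .
    \<comment> \<open>Prices stay below \<open>b\<close> while a unit is held, so the limit is
      finite and convergence passes to the reals.\<close>
    have "L \<le> ereal b"
      using holds_less[OF assms(1) h]
      by (intro LIMSEQ_le_const2[OF assms(3)]) (auto intro!: exI[of _ k] less_imp_le)
    moreover have "ereal (- c) \<le> L"
      using assms(2) by (intro LIMSEQ_le_const[OF assms(3)]) auto
    ultimately obtain r where r: "L = ereal r" by (cases L) auto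
    have "(\<lambda>n. ereal (holding a b v n)) \<longlonglongrightarrow> L"
      by (rule Lim_transform_eventually[OF assms(3)])
        (use holding_eq[OF assms(1) h assms(2)] in \<open>auto simp: eventually_sequentially intro!: exI[of _ k]\<close>)
    then show ?thesis unfolding r by (auto simp: convergent_def)
  next
    case False
    then have "holding a b v n = a" if "n \<ge> m" for n
      using that by (auto simp: holding_def)
    then have "holding a b v \<longlonglongrightarrow> a"
      by (intro tendsto_eventually) (auto simp: eventually_sequentially)
    then show ?thesis by (auto simp: convergent_def)
  qed
qed

section \<open>Mixing the upcrossing strategies\<close>

text \<open>The denominator exceeds both \<open>b - a\<close> and the bound on the holding, so
  either one contributes at most \<open>(1/2)^k\<close> after weighting.\<close>

definition weight :: "real \<Rightarrow> real \<Rightarrow> real \<Rightarrow> nat \<Rightarrow> real" where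
  "weight c a b k = (1/2)^k / (1 + \<bar>a\<bar> + \<bar>b\<bar> + \<bar>c\<bar>)"

text \<open>The added \<open>(1/2)^k\<close> compensates a negative weighted holding and makes every
  term nonnegative.\<close>

definition mixture ::
  "real \<Rightarrow> (nat \<Rightarrow> real) \<Rightarrow> (nat \<Rightarrow> real) \<Rightarrow> (nat \<Rightarrow> ereal) \<Rightarrow> nat \<Rightarrow> real" where
  "mixture c a b v n = (\<Sum>k. weight c (a k) (b k) k * capital (a k) (b k) v n + (1/2)^k)"

lemma weight_pos: "0 < weight c a b k"
  by (simp add: weight_def add_pos_nonneg)

lemma weight_mult_le:
  assumes "\<bar>y\<bar> \<le> \<bar>a\<bar> + \<bar>b\<bar> + \<bar>c\<bar>"
  shows "\<bar>weight c a b k * y\<bar> \<le> (1/2)^k"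
proof -
  have "\<bar>y\<bar> / (1 + \<bar>a\<bar> + \<bar>b\<bar> + \<bar>c\<bar>) \<le> 1" using assms by simp
  then have "(1/2)^k * (\<bar>y\<bar> / (1 + \<bar>a\<bar> + \<bar>b\<bar> + \<bar>c\<bar>)) \<le> (1/2)^k"
    by (rule mult_left_le) simp
  then show ?thesis by (simp add: weight_def abs_mult)
qed

lemma summable_half_powers: "summable (\<lambda>k. d * (1/2::real)^k)"
  by (intro summable_mult summable_geometric) simp

context
  fixes a b :: "nat \<Rightarrow> real" and c :: real
  assumes less: "\<And>k. a k < b k"
begin

text \<open>Each term splits into a part increasing in \<open>n\<close> and possibly unbounded, and
  a part dominated uniformly in \<open>n\<close>.\<close>

abbreviation gain where
  "gain v k n \<equiv> weight c (a k) (b k) k * ((b k - a k) * real (sales (a k) (b k) v n))"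

abbreviation rest where
  "rest v k n \<equiv> weight c (a k) (b k) k * holding (a k) (b k) v n + (1/2)^k"

lemma gain_nonneg: "0 \<le> gain v k n"
  using less[of k] weight_pos[of c "a k" "b k" k] by simp

lemma gain_mono: "m \<le> n \<Longrightarrow> gain v k m \<le> gain v k n"
  using less[of k] weight_pos[of c "a k" "b k" k] incseq_sales[of "a k" "b k" v]
  by (intro mult_left_mono) (auto dest: incseqD)

text \<open>At most one sale happens per step; this gives summability for each fixed
  \<open>n\<close>, not uniformly in \<open>n\<close>.\<close>

lemma gain_le: "gain v k n \<le> real n * (1/2)^k"
proof -
  have "gain v k n = (weight c (a k) (b k) k * (b k - a k)) * real (sales (a k) (b k) v n)"
    by simp
  also have "\<dots> \<le> (1/2)^k * real n"
    using weight_mult_le[of "b k - a k" "a k" "b k" c k] less[of k] sales_le[of "a k" "b k" v n]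
      weight_pos[of c "a k" "b k" k]
    by (intro mult_mono) auto
  finally show ?thesis by (simp add: mult.commute)
qed

lemma rest_bounds:
  assumes "\<And>n. ereal (- c) \<le> v n"
  shows "0 \<le> rest v k n" "rest v k n \<le> 2 * (1/2)^k"
  using weight_mult_le[OF abs_holding_le[where v = v and n = n, OF less[of k] assms], of k] by auto

lemma summable_gain: "summable (\<lambda>k. gain v k n)"
  by (rule summable_comparison_test[OF _ summable_half_powers[of "real n"]])
    (use gain_le gain_nonneg in \<open>auto simp del: mult_nonneg_nonneg\<close>)

lemma summable_rest:
  assumes "\<And>n. ereal (- c) \<le> v n"
  shows "summable (\<lambda>k. rest v k n)"
  by (rule summable_comparison_test[OF _ summable_half_powers[of 2]])
    (use rest_bounds[where v = v, OF assms] in auto)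

lemma mixture_term_eq:
  "weight c (a k) (b k) k * capital (a k) (b k) v n + (1/2)^k = gain v k n + rest v k n"
  by (simp add: capital_def algebra_simps)

lemma mixture_eq:
  assumes "\<And>n. ereal (- c) \<le> v n"
  shows "mixture c a b v n = (\<Sum>k. gain v k n) + (\<Sum>k. rest v k n)"
  unfolding mixture_def mixture_term_eq
  by (rule suminf_add[symmetric]) (intro summable_gain summable_rest assms)+

lemma mixture_nonneg:
  assumes "\<And>n. ereal (- c) \<le> v n"
  shows "0 \<le> mixture c a b v n"
  unfolding mixture_eq[OF assms]
  by (intro add_nonneg_nonneg suminf_nonneg summable_gain summable_rest gain_nonneg
      rest_bounds assms)

lemma content_mixture:
  fixes h :: "'a \<Rightarrow> ereal"
  assumes E: "outer_prob_content E"
    and low: "\<And>i. ereal (- c) \<le> v i" "\<And>x. ereal (- c) \<le> h x"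
    and le: "E h \<le> v n"
  shows "E (\<lambda>x. ereal (mixture c a b (v(Suc n := h x)) (Suc n))) \<le> ereal (mixture c a b v n)"
  unfolding mixture_def
proof (rule content_suminf[OF E])
  fix k
  show "E (\<lambda>x. ereal (weight c (a k) (b k) k * capital (a k) (b k) (v(Suc n := h x)) (Suc n) + (1/2)^k))
      \<le> ereal (weight c (a k) (b k) k * capital (a k) (b k) v n + (1/2)^k)"
    by (intro content_affine[OF E] weight_pos content_capital[where v = v and h = h, OF E less low le])
next
  fix k x
  have "ereal (- c) \<le> (v(Suc n := h x)) i" for i
    using low by simp
  \<comment> \<open>The majorant adds the bound on the gain at time \<open>Suc n\<close> to the
    bound \<open>2 * (1/2)^k\<close> on the rest.\<close>
  from rest_bounds[where v = "v(Suc n := h x)" and k = k and n = "Suc n", OF this] gain_nonneg[where v = "v(Suc n := h x)" and k = k and n = "Suc n"]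
    gain_le[where v = "v(Suc n := h x)" and k = k and n = "Suc n"]
  show "\<bar>weight c (a k) (b k) k * capital (a k) (b k) (v(Suc n := h x)) (Suc n) + (1/2)^k\<bar>
      \<le> (real (Suc n) + 2) * (1/2)^k"
    unfolding mixture_term_eq distrib_right by linarith
next
  show "summable (\<lambda>k. (real (Suc n) + 2) * (1/2)^k)"
    by (rule summable_half_powers)
  show "summable (\<lambda>k. weight c (a k) (b k) k * capital (a k) (b k) v n + (1/2)^k)"
    unfolding mixture_term_eq by (intro summable_add summable_gain summable_rest low)
qed

text \<open>If \<open>liminf\<close> and \<open>limsup\<close> differ, some interval of the family
  lies strictly between them and is crossed infinitely often. Convergence is in the extended
  reals.\<close>

lemma convergent_if_sales_bounded:
  assumes dense: "\<And>x y. x < y \<Longrightarrow> \<exists>k. x < ereal (a k) \<and> ereal (b k) < y"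
    and bdd: "\<And>k. \<exists>K. \<forall>n. sales (a k) (b k) v n \<le> K"
  shows "convergent v"
proof (rule ccontr)
  assume "\<not> convergent v"
  then have "liminf v < limsup v"
    using Liminf_le_Limsup[of sequentially v] by (auto simp: convergent_ereal order_less_le)
  then obtain k where k: "liminf v < ereal (a k)" "ereal (b k) < limsup v"
    using dense by blast
  have "frequently (\<lambda>n. v n < ereal (a k)) sequentially"
    using k(1) Liminf_bounded[of "ereal (a k)" v sequentially]
    by (auto simp: frequently_def not_less)
  moreover have "frequently (\<lambda>n. v n > ereal (b k)) sequentially"
    using k(2) Limsup_bounded[of v "ereal (b k)" sequentially]
    by (auto simp: frequently_def not_less)
  ultimately show False
    using sales_unbounded[of v "a k" "b k"] bdd[of k] by (metis not_le)
qed

text \<open>The gains increase along the path, so their sum either tends to infinity or is bounded; in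
  the latter case every number of sales is bounded, \<open>v\<close> converges, and so do the remaining terms,
  which are dominated by a summable sequence.\<close>

lemma mixture_dichotomy:
  assumes low: "\<And>n. ereal (- c) \<le> v n"
    and dense: "\<And>x y. x < y \<Longrightarrow> \<exists>k. x < ereal (a k) \<and> ereal (b k) < y"
  shows "filterlim (mixture c a b v) at_top sequentially
    \<or> (convergent (mixture c a b v) \<and> convergent v)"
proof -
  define G where "G n = (\<Sum>k. gain v k n)" for n
  define R where "R n = (\<Sum>k. rest v k n)" for n
  have mix: "mixture c a b v = (\<lambda>n. G n + R n)"
    using mixture_eq[OF low] by (auto simp: G_def R_def)
  have "incseq G"
    unfolding G_def by (intro monoI suminf_le gain_mono summable_gain)
  have R: "0 \<le> R n" for n
    unfolding R_def by (intro suminf_nonneg summable_rest rest_bounds low)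
  show ?thesis
  proof (cases "\<exists>Z. \<forall>n. G n \<le> Z")
    case False
    have "filterlim G at_top sequentially"
      unfolding filterlim_at_top eventually_sequentially
      using False \<open>incseq G\<close> by (meson incseqD linear order_trans)
    then have "filterlim (mixture c a b v) at_top sequentially"
      unfolding mix by (rule filterlim_at_top_mono) (use R in auto)
    then show ?thesis ..
  next
    case True
    then obtain Z where Z: "\<And>n. G n \<le> Z" by blast
    have bdd: "\<exists>K. \<forall>n. sales (a k) (b k) v n \<le> K" for k
    proof (intro exI allI)
      fix n
      define w where "w = weight c (a k) (b k) k * (b k - a k)"
      have "w > 0" using less[of k] weight_pos[of c "a k" "b k" k] by (simp add: w_def)
      \<comment> \<open>A single gain is at most the sum of all; the resulting bound on the sales
        may depend on \<open>k\<close>.\<close>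
      have "sum (\<lambda>k. gain v k n) {k} \<le> G n"
        unfolding G_def by (intro sum_le_suminf summable_gain gain_nonneg) auto
      then have "w * real (sales (a k) (b k) v n) \<le> Z"
        using Z[of n] by (simp add: w_def)
      then have "real (sales (a k) (b k) v n) \<le> Z / w"
        using \<open>w > 0\<close> by (simp add: field_simps)
      then show "sales (a k) (b k) v n \<le> nat \<lfloor>Z / w\<rfloor>"
        by (simp add: le_nat_floor)
    qed
    have "convergent v"
      by (rule convergent_if_sales_bounded[OF dense bdd])
    then obtain L where L: "v \<longlonglongrightarrow> L" by (auto simp: convergent_def)
    have "convergent (\<lambda>n. rest v k n)" for k
      using bdd[of k] convergent_holding[OF less[of k] low L]
      by (intro convergent_add convergent_mult convergent_const) blast
    then obtain l where l: "(\<lambda>n. rest v k n) \<longlonglongrightarrow> l k" for k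
      unfolding convergent_def by metis
    \<comment> \<open>Tannery's theorem, with majorant \<open>2 * (1/2)^k\<close>, exchanges limit
      and sum.\<close>
    have "R \<longlonglongrightarrow> suminf l"
      unfolding R_def
      by (rule tannerys_theorem[THEN conjunct2, THEN conjunct2, OF l _ summable_half_powers[of 2]])
        (use rest_bounds[where v = v, OF low] in \<open>auto intro!: always_eventually\<close>)
    moreover have "convergent G"
      using incseq_convergent[OF \<open>incseq G\<close>, of Z] Z unfolding convergent_def by metis
    ultimately have "convergent (mixture c a b v)"
      unfolding mix by (intro convergent_add) (auto simp: convergent_def)
    with \<open>convergent v\<close> show ?thesis by blast
  qed
qed

end

lemma dense_interval_sequence:
  obtains a b :: "nat \<Rightarrow> real"
  where "\<And>k. a k < b k"
    and "\<And>x y :: ereal. x < y \<Longrightarrow> \<exists>k. x < ereal (a k) \<and> ereal (b k) < y"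
proof
  \<comment> \<open>All pairs of rationals are enumerated; pairs in the wrong order default to the
    interval from 0 to 1.\<close>
  define q :: "nat \<Rightarrow> rat \<times> rat" where "q = from_nat"
  define a where "a k = (if fst (q k) < snd (q k) then real_of_rat (fst (q k)) else 0)" for k
  define b where "b k = (if fst (q k) < snd (q k) then real_of_rat (snd (q k)) else 1)" for k
  show "a k < b k" for k
    by (simp add: a_def b_def of_rat_less)
  show "\<exists>k. x < ereal (a k) \<and> ereal (b k) < y" if less: "x < y" for x y :: ereal
  proof -
    \<comment> \<open>Three reals between \<open>x\<close> and \<open>y\<close> leave two disjoint
      gaps, each with room for a rational endpoint.\<close>
    obtain r where r: "x < ereal r" "ereal r < y" using ereal_dense2[OF less] by blast
    obtain t where t: "ereal r < ereal t" "ereal t < y" using ereal_dense2[OF r(2)] by blast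
    obtain u where u: "ereal t < ereal u" "ereal u < y" using ereal_dense2[OF t(2)] by blast
    obtain p where p: "r < real_of_rat p" "real_of_rat p < t" using of_rat_dense t(1) by auto
    obtain p' where p': "t < real_of_rat p'" "real_of_rat p' < u" using of_rat_dense u(1) by auto
    have "p < p'" using p p' by (metis less_trans of_rat_less)
    moreover have "x < ereal (real_of_rat p)"
      using r(1) p(1) by (metis less_ereal.simps(1) less_trans)
    moreover have "ereal (real_of_rat p') < y"
      using u(2) p'(2) by (metis less_ereal.simps(1) less_trans)
    ultimately show ?thesis
      by (intro exI[of _ "to_nat (p, p')"]) (simp add: a_def b_def q_def)
  qed
qed

section \<open>Supermartingales\<close>

lemma supermartingaleD:
  "supermartingale \<E> S \<Longrightarrow> \<E> (Suc (length t)) (\<lambda>x. S (t @ [x])) \<le> S t"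
  unfolding supermartingale_def by (metis One_nat_def diff_Suc_1 le_add1 plus_1_eq_Suc)

lemma supermartingaleI:
  assumes "\<And>t. \<E> (Suc (length t)) (\<lambda>x. S (t @ [x])) \<le> S t"
  shows "supermartingale \<E> S"
  unfolding supermartingale_def
proof (intro allI impI)
  fix n and t :: "'a list"
  assume "1 \<le> n" "length t = n - 1"
  then show "\<E> n (\<lambda>x. S (t @ [x])) \<le> S t" using assms[of t] by simp
qed

context
  fixes \<E> :: "nat \<Rightarrow> ('a \<Rightarrow> ereal) \<Rightarrow> ereal"
  assumes content: "\<And>n. n \<ge> 1 \<Longrightarrow> outer_prob_content (\<E> n)"
begin

lemma supermartingale_add:
  assumes "supermartingale \<E> S" "supermartingale \<E> T"
  shows "supermartingale \<E> (\<lambda>t. S t + T t)"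
proof (rule supermartingaleI)
  fix t :: "'a list"
  have "\<E> (Suc (length t)) (\<lambda>x. S (t @ [x]) + T (t @ [x]))
      \<le> \<E> (Suc (length t)) (\<lambda>x. S (t @ [x])) + \<E> (Suc (length t)) (\<lambda>x. T (t @ [x]))"
    by (intro content_add content) simp
  also have "\<dots> \<le> S t + T t"
    by (intro add_mono supermartingaleD assms)
  finally show "\<E> (Suc (length t)) (\<lambda>x. S (t @ [x]) + T (t @ [x])) \<le> S t + T t" .
qed

lemma supermartingale_scale:
  assumes "supermartingale \<E> (\<lambda>t. ereal (U t))" "0 < e"
  shows "supermartingale \<E> (\<lambda>t. ereal (e * U t))"
  using content_affine[OF content assms(2), of _ _ _ 0] supermartingaleD[OF assms(1)]
  by (intro supermartingaleI) auto

lemma ex_convergence_forcing_supermartingale: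
  assumes S: "supermartingale \<E> S" and low: "\<And>t. ereal (- c) \<le> S t"
  obtains U where "supermartingale \<E> (\<lambda>t. ereal (U t))" "\<And>t. 0 \<le> U t"
    "\<And>\<omega>. filterlim (\<lambda>n. U (stake n \<omega>)) at_top sequentially
       \<or> (convergent (\<lambda>n. U (stake n \<omega>)) \<and> convergent (\<lambda>n. S (stake n \<omega>)))"
proof -
  obtain a b :: "nat \<Rightarrow> real" where less: "\<And>k. a k < b k"
    and dense: "\<And>x y :: ereal. x < y \<Longrightarrow> \<exists>k. x < ereal (a k) \<and> ereal (b k) < y"
    using dense_interval_sequence by blast
  \<comment> \<open>Beyond \<open>length t\<close> the sequence is constantly \<open>S t\<close>,
    but by non-anticipation these values are not seen.\<close>
  define U where "U t = mixture c a b (\<lambda>i. S (take i t)) (length t)" for t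
  have cong: "mixture c a b v n = mixture c a b w n" if "\<And>i. i \<le> n \<Longrightarrow> v i = w i" for v w n
    unfolding mixture_def using capital_cong[of n v w] that by simp
  show thesis
  proof (rule that[of U])
    show "supermartingale \<E> (\<lambda>t. ereal (U t))"
    proof (rule supermartingaleI)
      fix t
      let ?v = "\<lambda>i. S (take i t)"
      have "U (t @ [x]) = mixture c a b (?v(Suc (length t) := S (t @ [x]))) (Suc (length t))" for x
        unfolding U_def length_append_singleton by (rule cong) (auto simp: le_Suc_eq)
      moreover have "\<E> (Suc (length t))
          (\<lambda>x. ereal (mixture c a b (?v(Suc (length t) := S (t @ [x]))) (Suc (length t))))
          \<le> ereal (U t)"
        unfolding U_def using supermartingaleD[OF S, of t]
        by (intro content_mixture content less low) auto
      ultimately show "\<E> (Suc (length t)) (\<lambda>x. ereal (U (t @ [x]))) \<le> ereal (U t)" by simp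
    qed
    show "0 \<le> U t" for t
      unfolding U_def by (intro mixture_nonneg less low)
    fix \<omega>
    have "U (stake n \<omega>) = mixture c a b (\<lambda>n. S (stake n \<omega>)) n" for n
      unfolding U_def length_stake by (rule cong) (simp add: take_stake min_absorb1)
    then have "(\<lambda>n. U (stake n \<omega>)) = mixture c a b (\<lambda>n. S (stake n \<omega>))" by blast
    then show "filterlim (\<lambda>n. U (stake n \<omega>)) at_top sequentially
       \<or> (convergent (\<lambda>n. U (stake n \<omega>)) \<and> convergent (\<lambda>n. S (stake n \<omega>)))"
      using mixture_dichotomy[OF less low dense, of "\<lambda>n. stake n \<omega>"] by simp
  qed
qed

text \<open>\<open>T\<close> is \<open>S\<close> plus a small multiple of \<open>U\<close>. Where
  \<open>U\<close> tends to infinity, so does \<open>T\<close>; elsewhere \<open>S\<close> converges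
  too, and the nonnegative addition only raises the limit.\<close>

lemma ex_convergent_above_limsup:
  assumes S: "supermartingale \<E> S" and bdd: "bounded_below S"
    and fin: "S s < \<infinity>" and e: "0 < e"
  obtains T where "T \<in> convergent_supermartingales \<E>" "T s \<le> S s + ereal e"
    "\<And>\<omega>. limsup (\<lambda>n. S (stake n \<omega>)) \<le> lim (\<lambda>n. T (stake n \<omega>))"
proof -
  \<comment> \<open>The infimum may be infinite, hence a real strictly below it.\<close>
  from bdd obtain c where "ereal (- c) < (INF t. S t)"
    unfolding bounded_below_def using ereal_dense2 by (metis minus_minus)
  then have low: "ereal (- c) \<le> S t" for t
    by (meson INF_lower UNIV_I less_imp_le order_trans)
  obtain U where U: "supermartingale \<E> (\<lambda>t. ereal (U t))" "\<And>t. 0 \<le> U t"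
    and dich: "\<And>\<omega>. filterlim (\<lambda>n. U (stake n \<omega>)) at_top sequentially
       \<or> (convergent (\<lambda>n. U (stake n \<omega>)) \<and> convergent (\<lambda>n. S (stake n \<omega>)))"
    using ex_convergence_forcing_supermartingale[OF S low] by blast
  \<comment> \<open>\<open>U s / (1 + U s)\<close> is at most 1, so the cost at \<open>s\<close> is
    at most \<open>e\<close>, also when \<open>U s = 0\<close>.\<close>
  define d where "d = e / (1 + U s)"
  have d: "0 < d" "d * U s \<le> e"
    using e U(2)[of s] by (auto simp: d_def field_simps)
  define T where "T t = S t + ereal (d * U t)" for t
  have ge: "S t \<le> T t" for t
    unfolding T_def using U(2)[of t] d(1) by (simp add: ereal_le_add_self)
  have lim: "\<exists>L. -\<infinity> < L \<and> limsup (\<lambda>n. S (stake n \<omega>)) \<le> L \<and> (\<lambda>n. T (stake n \<omega>)) \<longlonglongrightarrow> L" for \<omega>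
    using dich[of \<omega>]
  proof
    assume top: "filterlim (\<lambda>n. U (stake n \<omega>)) at_top sequentially"
    have "(\<lambda>n. ereal (- c + d * U (stake n \<omega>))) \<longlonglongrightarrow> \<infinity>"
      unfolding tendsto_PInfty_eq_at_top
      by (intro filterlim_tendsto_add_at_top[OF tendsto_const]
          filterlim_tendsto_pos_mult_at_top[OF tendsto_const d(1) top])
    moreover have "ereal (- c + d * U t) \<le> T t" for t
      unfolding T_def using add_mono[OF low order_refl, of "ereal (d * U t)" t] by simp
    ultimately have "(\<lambda>n. T (stake n \<omega>)) \<longlonglongrightarrow> \<infinity>"
      unfolding tendsto_PInfty by (blast intro: eventually_mono less_le_trans)
    then show ?thesis by (intro exI[of _ \<infinity>]) simp
  next
    assume "convergent (\<lambda>n. U (stake n \<omega>)) \<and> convergent (\<lambda>n. S (stake n \<omega>))"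
    then obtain L M where L: "(\<lambda>n. S (stake n \<omega>)) \<longlonglongrightarrow> L" and M: "(\<lambda>n. U (stake n \<omega>)) \<longlonglongrightarrow> M"
      by (auto simp: convergent_def)
    have "0 \<le> M" using U(2) by (intro LIMSEQ_le_const[OF M]) auto
    have "ereal (- c) \<le> L" using low by (intro LIMSEQ_le_const[OF L]) auto
    \<comment> \<open>\<open>L\<close> may be infinite, but addition is continuous away from minus
      infinity.\<close>
    then have "L \<noteq> -\<infinity>" by auto
    have "(\<lambda>n. T (stake n \<omega>)) \<longlonglongrightarrow> L + ereal (d * M)"
      unfolding T_def using \<open>L \<noteq> -\<infinity>\<close> M
      by (intro tendsto_add_ereal_nonneg L) (auto intro!: tendsto_intros)
    moreover have "L \<le> L + ereal (d * M)"
      using \<open>0 \<le> M\<close> d(1) by (simp add: ereal_le_add_self)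
    moreover have "limsup (\<lambda>n. S (stake n \<omega>)) = L"
      using lim_imp_Limsup[OF _ L] by simp
    ultimately show ?thesis
      using \<open>L \<noteq> -\<infinity>\<close> by (intro exI[of _ "L + ereal (d * M)"]) (cases L; auto)
  qed
  show thesis
  proof (rule that[of T])
    have "supermartingale \<E> T"
      unfolding T_def by (intro supermartingale_add S supermartingale_scale U d)
    moreover have "ereal (- c) \<le> (INF t. T t)"
      using low ge by (intro INF_greatest) (meson order_trans)
    then have "bounded_below T"
      unfolding bounded_below_def by (auto intro: less_le_trans[rotated])
    ultimately show "T \<in> convergent_supermartingales \<E>"
      unfolding convergent_supermartingales_def using lim by blast
    show "T s \<le> S s + ereal e"
      unfolding T_def using d(2) by (intro add_left_mono) simp
    show "limsup (\<lambda>n. S (stake n \<omega>)) \<le> lim (\<lambda>n. T (stake n \<omega>))" for \<omega>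
      using lim[of \<omega>] limI by metis
  qed
qed

end

section \<open>Cyclic comparison of the three infima\<close>

theorem theorem1:
  fixes \<E> :: "nat \<Rightarrow> ('a \<Rightarrow> ereal) \<Rightarrow> ereal"
    and \<xi> :: "'a stream \<Rightarrow> ereal"
    and s :: "'a list"
  assumes "\<And>n. n \<ge> 1 \<Longrightarrow> outer_prob_content (\<E> n)"
  shows "upper_expectation \<E> \<xi> s =
           Inf {S s | S. supermartingale \<E> S \<and> bounded_below S \<and>
             (\<forall>\<omega>\<in>cylinder s. limsup (\<lambda>n. S (stake n \<omega>)) \<ge> \<xi> \<omega>)} \<and>
         upper_expectation \<E> \<xi> s =
           Inf {S s | S. S \<in> convergent_supermartingales \<E> \<and>
             (\<forall>\<omega>\<in>cylinder s. lim (\<lambda>n. S (stake n \<omega>)) \<ge> \<xi> \<omega>)}"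
proof -
  let ?A = "{S s | S. supermartingale \<E> S \<and> bounded_below S \<and>
    (\<forall>\<omega>\<in>cylinder s. liminf (\<lambda>n. S (stake n \<omega>)) \<ge> \<xi> \<omega>)}"
  let ?B = "{S s | S. supermartingale \<E> S \<and> bounded_below S \<and>
    (\<forall>\<omega>\<in>cylinder s. limsup (\<lambda>n. S (stake n \<omega>)) \<ge> \<xi> \<omega>)}"
  let ?C = "{S s | S. S \<in> convergent_supermartingales \<E> \<and>
    (\<forall>\<omega>\<in>cylinder s. lim (\<lambda>n. S (stake n \<omega>)) \<ge> \<xi> \<omega>)}"
  have "liminf v \<le> limsup v" for v :: "nat \<Rightarrow> ereal"
    by (simp add: Liminf_le_Limsup)
  then have BA: "Inf ?B \<le> Inf ?A"
    by (intro Inf_superset_mono) (blast intro: order_trans)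
  have AC: "Inf ?A \<le> Inf ?C"
  proof (rule Inf_superset_mono, safe)
    fix S assume S: "S \<in> convergent_supermartingales \<E>"
      and le: "\<forall>\<omega>\<in>cylinder s. \<xi> \<omega> \<le> lim (\<lambda>n. S (stake n \<omega>))"
    \<comment> \<open>\<open>lim\<close> is a definite description, so the existence of the limit is
      needed to identify it with \<open>liminf\<close>.\<close>
    have "lim (\<lambda>n. S (stake n \<omega>)) = liminf (\<lambda>n. S (stake n \<omega>))" for \<omega>
    proof -
      obtain L where "(\<lambda>n. S (stake n \<omega>)) \<longlonglongrightarrow> L"
        using S unfolding convergent_supermartingales_def by blast
      then show ?thesis using limI lim_imp_Liminf by (metis trivial_limit_sequentially)
    qed
    with S le show "\<exists>T. S s = T s \<and> supermartingale \<E> T \<and> bounded_below T \<and>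
        (\<forall>\<omega>\<in>cylinder s. \<xi> \<omega> \<le> liminf (\<lambda>n. T (stake n \<omega>)))"
      unfolding convergent_supermartingales_def by auto
  qed
  have CB: "Inf ?C \<le> Inf ?B"
  proof (rule Inf_greatest, clarify)
    fix S assume S: "supermartingale \<E> S" "bounded_below S"
      and le: "\<forall>\<omega>\<in>cylinder s. \<xi> \<omega> \<le> limsup (\<lambda>n. S (stake n \<omega>))"
    show "Inf ?C \<le> S s"
    \<comment> \<open>For finite \<open>S s\<close> the convergent modification costs an arbitrarily
      small \<open>e\<close>; for infinite \<open>S s\<close> the bound is trivial.\<close>
    proof (cases "S s < \<infinity>")
      case True
      show ?thesis
      proof (rule ereal_le_epsilon2)
        fix e :: real assume "0 < e"
        with True obtain T where T: "T \<in> convergent_supermartingales \<E>" "T s \<le> S s + ereal e"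
          "\<And>\<omega>. limsup (\<lambda>n. S (stake n \<omega>)) \<le> lim (\<lambda>n. T (stake n \<omega>))"
          using ex_convergent_above_limsup[OF assms S] by blast
        have "T s \<in> ?C" using T(1,3) le by (blast intro: order_trans)
        then show "Inf ?C \<le> S s + ereal e" using T(2) by (meson Inf_lower order_trans)
      qed
    qed simp
  qed
  show ?thesis
    unfolding upper_expectation_def
    using order_antisym[OF order_trans[OF AC CB] BA] order_antisym[OF AC order_trans[OF CB BA]] ..
qed

end
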